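(* Let $N\ge 1$ and let $\tau:\{1,\ldots,N\}\to\{0,1,2,\ldots\}$ be an admissible $\tau$-function of length $N$. Let $l_0>l_1>\cdots>l_k\ge 0$ be the integers associated to $\tau$ as follows: $k$ is the number of markers of $\tau$ appearing in the orbit $N\mapsto\tau(N)\mapsto\cdots\mapsto\tau^{\operatorname{ord}(N)}(N)=0$; these markers are labeled $l_1',\ldots,l_k'$ so that $N=l_0'>l_1'>\cdots>l_k'>0$; and $l_i=\tau(l_i')$ for $0\le i\le k$ (so $l_0=\tau(N)$). Then an extension of $\tau$ to a function on $\{1,\ldots,N+1\}$, determined by the value $\tau(N+1)$, is admissible if and only if either $$\tau(N+1)=l_i+1\quad\text{for some } 0\le i\le k,$$ or $\tau(N+1)=0$ and ($l_k>0$ or $k=0$).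
   Context: A function $\tau:\{1,\ldots,N\}\to\{0,1,2,\ldots\}$ is an admissible $\tau$-function of length $N$ if it satisfies the following properties (A)--(E), with (B)--(E) required for all $n$ with $1\le n\le N-1$: (A) $\tau(1)=0$; (B) $\tau(n+1)\le\tau(n)+1$; (C) if $\tau(n+1)<\tau^k(n)+1$ for some $0<k<\operatorname{ord}(n)$, then $\tau(n+1)\le\tau^{k+1}(n)+1$; (D) if $\tau(n+1)<\tau^k(n)+1$ for some $0<k<\operatorname{ord}(n)$, and if $\tau(\tau^k(n)+1)=\tau^{k+1}(n)+1$, then $\tau(n+1)<\tau^{k+1}(n)+1$; (E) if $\operatorname{ord}(n)>1$ and $\operatorname{ord}(\tau^{\operatorname{ord}(n)-1}(n)+1)=1$, then $\tau(n+1)\ne0$. Here $\tau^k$ is the $k$-th iterate; (A) and (B) imply $\tau(n)<n$, and $\operatorname{ord}(n)\geq 1$ denotes the unique integer with $\tau^{\operatorname{ord}(n)}(n)=0$. The markers of a $\tau$-function of length $N$ are the integers $m\in\{1,\ldots,N-1\}$ with $\tau(m+1)<\tau(m)+1$. *)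

theory Defs
  imports Main
begin

text \<open>
  A function on \<open>{1..N}\<close> is represented by a function \<open>nat \<Rightarrow> nat\<close> of which only the
  values on \<open>{1..N}\<close> are ever used.
\<close>

text \<open>
  The value \<open>\<tau> 0\<close> is junk, so the orbit of \<open>n\<close> has to be stopped at its first visit to \<open>0\<close>;
  this is what \<open>LEAST\<close> does. For \<open>n \<ge> 1\<close> in the domain of an admissible function the
  iterates do reach \<open>0\<close>, see \<open>tau_ord_props\<close> below.
\<close>

definition tau_ord :: "(nat \<Rightarrow> nat) \<Rightarrow> nat \<Rightarrow> nat" where
  "tau_ord \<tau> n = (LEAST k. (\<tau> ^^ k) n = 0)"

definition admissible :: "nat \<Rightarrow> (nat \<Rightarrow> nat) \<Rightarrow> bool" where
  "admissible N \<tau> \<longleftrightarrow>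
     \<tau> 1 = 0 \<and>
     (\<forall>n\<in>{1..<N}.
        \<tau> (n + 1) \<le> \<tau> n + 1 \<and>
        (\<forall>k. 0 < k \<and> k < tau_ord \<tau> n \<and> \<tau> (n + 1) < (\<tau> ^^ k) n + 1
             \<longrightarrow> \<tau> (n + 1) \<le> (\<tau> ^^ (k + 1)) n + 1) \<and>
        (\<forall>k. 0 < k \<and> k < tau_ord \<tau> n \<and> \<tau> (n + 1) < (\<tau> ^^ k) n + 1 \<and>
             \<tau> ((\<tau> ^^ k) n + 1) = (\<tau> ^^ (k + 1)) n + 1
             \<longrightarrow> \<tau> (n + 1) < (\<tau> ^^ (k + 1)) n + 1) \<and>
        (tau_ord \<tau> n > 1 \<and> tau_ord \<tau> ((\<tau> ^^ (tau_ord \<tau> n - 1)) n + 1) = 1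
             \<longrightarrow> \<tau> (n + 1) \<noteq> 0))"

definition markers :: "nat \<Rightarrow> (nat \<Rightarrow> nat) \<Rightarrow> nat set" where
  "markers N \<tau> = {m \<in> {1..<N}. \<tau> (m + 1) < \<tau> m + 1}"

definition orbit :: "(nat \<Rightarrow> nat) \<Rightarrow> nat \<Rightarrow> nat set" where
  "orbit \<tau> n = {(\<tau> ^^ j) n | j. j \<le> tau_ord \<tau> n}"

definition orbit_markers :: "nat \<Rightarrow> (nat \<Rightarrow> nat) \<Rightarrow> nat set" where
  "orbit_markers N \<tau> = markers N \<tau> \<inter> orbit \<tau> N"

definition marker_count :: "nat \<Rightarrow> (nat \<Rightarrow> nat) \<Rightarrow> nat" where
  "marker_count N \<tau> = card (orbit_markers N \<tau>)"

text \<open>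
  \<open>marker_label N \<tau> i\<close> is \<open>l\<^sub>i'\<close> and \<open>marker_value N \<tau> i\<close> is \<open>l\<^sub>i\<close>; they are meaningful for
  \<open>i \<le> marker_count N \<tau>\<close> only.
\<close>

definition marker_label :: "nat \<Rightarrow> (nat \<Rightarrow> nat) \<Rightarrow> nat \<Rightarrow> nat" where
  "marker_label N \<tau> i = (N # rev (sorted_list_of_set (orbit_markers N \<tau>))) ! i"

definition marker_value :: "nat \<Rightarrow> (nat \<Rightarrow> nat) \<Rightarrow> nat \<Rightarrow> nat" where
  "marker_value N \<tau> i = \<tau> (marker_label N \<tau> i)"

lemma admissible_less:
  assumes "admissible N \<tau>" and "1 \<le> n" and "n \<le> N"
  shows "\<tau> n < n"
  using assms(2,3)
proof (induction n rule: nat_induct_at_least)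
  case base
  then show ?case using assms(1) by (simp add: admissible_def)
next
  case (Suc n)
  then have "\<tau> (n + 1) \<le> \<tau> n + 1"
    using assms(1) by (simp add: admissible_def)
  with Suc show ?case by simp
qed

lemma tau_ord_props:
  assumes adm: "admissible N \<tau>" and n: "1 \<le> n" "n \<le> N"
  shows "(\<tau> ^^ tau_ord \<tau> n) n = 0" and "1 \<le> tau_ord \<tau> n"
    and "\<And>j. j < tau_ord \<tau> n \<Longrightarrow> 0 < (\<tau> ^^ j) n"
proof -
  have "\<exists>k. (\<tau> ^^ k) n = 0"
    using n
  proof (induction n rule: less_induct)
    case (less n)
    show ?case
    proof (cases "\<tau> n = 0")
      case True
      then have "(\<tau> ^^ 1) n = 0" by simp
      then show ?thesis by blast
    next
      case False
      with less admissible_less[OF adm] obtain k where "(\<tau> ^^ k) (\<tau> n) = 0"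
        by (metis One_nat_def Suc_leI le_trans less_imp_le not_gr_zero)
      then have "(\<tau> ^^ Suc k) n = 0" by (simp add: funpow_swap1)
      then show ?thesis by blast
    qed
  qed
  then show z: "(\<tau> ^^ tau_ord \<tau> n) n = 0"
    unfolding tau_ord_def by (rule LeastI_ex)
  show "1 \<le> tau_ord \<tau> n"
    using z n by (cases "tau_ord \<tau> n") auto
  show "0 < (\<tau> ^^ j) n" if "j < tau_ord \<tau> n" for j
    using not_less_Least[OF that[unfolded tau_ord_def]] by simp
qed

lemma orbit_step:
  assumes adm: "admissible N \<tau>" and N: "1 \<le> N"
    and x: "x \<in> orbit \<tau> N" and y: "y \<in> orbit \<tau> N" and "0 < y" "y < x"
  shows "\<tau> y < \<tau> x"
proof -
  have bnd: "(\<tau> ^^ j) N \<le> N" if "j \<le> tau_ord \<tau> N" for j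
    using that
  proof (induction j)
    case (Suc j)
    then have "0 < (\<tau> ^^ j) N" using tau_ord_props(3)[OF adm N order_refl, of j] by simp
    with Suc admissible_less[OF adm, of "(\<tau> ^^ j) N"] show ?case by simp
  qed simp
  have dec: "(\<tau> ^^ j) N < (\<tau> ^^ i) N" if "i < j" "j \<le> tau_ord \<tau> N" for i j
    using that
  proof (induction j)
    case (Suc j)
    have "0 < (\<tau> ^^ j) N" using Suc.prems tau_ord_props(3)[OF adm N order_refl, of j] by simp
    then have "(\<tau> ^^ Suc j) N < (\<tau> ^^ j) N"
      using bnd[of j] Suc.prems admissible_less[OF adm, of "(\<tau> ^^ j) N"] by simp
    with Suc show ?case by (cases "i = j") auto
  qed simp
  obtain a where a: "a \<le> tau_ord \<tau> N" "x = (\<tau> ^^ a) N" using x by (auto simp: orbit_def)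
  obtain b where b: "b \<le> tau_ord \<tau> N" "y = (\<tau> ^^ b) N" using y by (auto simp: orbit_def)
  have "b \<noteq> tau_ord \<tau> N"
    using tau_ord_props(1)[OF adm N order_refl] b \<open>0 < y\<close> by auto
  moreover have "a < b"
    using dec[of b a] a b \<open>y < x\<close> by (metis linorder_neqE_nat order_less_asym)
  ultimately have "(\<tau> ^^ Suc b) N < (\<tau> ^^ Suc a) N"
    using dec[of "Suc a" "Suc b"] b by simp
  then show ?thesis using a b by simp
qed

lemma finite_orbit_markers: "finite (orbit_markers N \<tau>)"
  by (auto simp: orbit_markers_def markers_def)

lemma marker_label_set:
  "marker_label N \<tau> ` {1..marker_count N \<tau>} = orbit_markers N \<tau>"
proof -
  let ?xs = "rev (sorted_list_of_set (orbit_markers N \<tau>))"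
  have "marker_label N \<tau> ` {1..marker_count N \<tau>} = (\<lambda>i. ?xs ! i) ` {0..<marker_count N \<tau>}"
    unfolding image_Suc_atLeastLessThan[symmetric]
      atLeastLessThanSuc_atLeastAtMost[symmetric] One_nat_def image_image
    by (simp add: marker_label_def)
  also have "\<dots> = set ?xs"
    by (subst set_conv_nth) (auto simp: marker_count_def)
  finally show ?thesis by (simp add: finite_orbit_markers)
qed

lemma marker_label_decreasing:
  assumes "i < j" and "j \<le> marker_count N \<tau>"
  shows "marker_label N \<tau> j < marker_label N \<tau> i"
proof -
  have "sorted_wrt (>) (N # rev (sorted_list_of_set (orbit_markers N \<tau>)))"
    using strict_sorted_list_of_set[of "orbit_markers N \<tau>"]
    by (auto simp: sorted_wrt_rev finite_orbit_markers orbit_markers_def markers_def)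
  from sorted_wrt_nth_less[OF this assms(1)] assms(2) show ?thesis
    by (simp add: marker_label_def marker_count_def)
qed

lemma marker_value_decreasing:
  assumes adm: "admissible N \<tau>" and N: "1 \<le> N"
    and ij: "i < j" "j \<le> marker_count N \<tau>"
  shows "marker_value N \<tau> j < marker_value N \<tau> i"
proof -
  have m: "marker_label N \<tau> r \<in> orbit_markers N \<tau>" if "1 \<le> r" "r \<le> marker_count N \<tau>" for r
    using marker_label_set[of N \<tau>] that by fastforce
  have "(\<tau> ^^ 0) N \<in> orbit \<tau> N" unfolding orbit_def by blast
  then have "marker_label N \<tau> 0 \<in> orbit \<tau> N" by (simp add: marker_label_def)
  then have o: "marker_label N \<tau> r \<in> orbit \<tau> N" if "r \<le> marker_count N \<tau>" for r
    using m[of r] that by (cases "r = 0") (auto simp: orbit_markers_def)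
  have "0 < marker_label N \<tau> j"
    using m[of j] ij by (auto simp: orbit_markers_def markers_def)
  then show ?thesis
    unfolding marker_value_def
    using orbit_step[OF adm N o o] marker_label_decreasing[OF ij] ij by simp
qed

end

theory Submission
  imports Defs
begin

text \<open>
  Only the conditions at \<open>n = N\<close> are new. Write \<open>a\<^sub>k = \<tau>\<^sup>k(N)\<close> and \<open>r = ord(N)\<close>.
  By (B) and (C), \<open>\<tau>(N + 1)\<close> descends along the orbit until it is \<open>0\<close> or some \<open>a\<^sub>k + 1\<close>
  with \<open>1 \<le> k \<le> r\<close>. Condition (D) excludes \<open>a\<^bsub>k+1\<^esub> + 1\<close> exactly if \<open>a\<^sub>k\<close> is not a marker,
  and (E) excludes \<open>0\<close> exactly if \<open>a\<^bsub>r-1\<^esub>\<close> is a marker, that is, if \<open>0\<close> is the value of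
  \<open>\<tau>\<close> at a marker of the orbit.
\<close>

section \<open>The conditions at one argument\<close>

text \<open>These are (B)-(E) at \<open>n\<close> with a free \<open>v\<close> in the place of
  \<tau>(n+1), so that a candidate value can be tested against \<tau> alone.\<close>

definition admissible_step :: "(nat \<Rightarrow> nat) \<Rightarrow> nat \<Rightarrow> nat \<Rightarrow> bool" where
  "admissible_step \<tau> n v \<longleftrightarrow>
     v \<le> \<tau> n + 1 \<and>
     (\<forall>k. 0 < k \<and> k < tau_ord \<tau> n \<and> v < (\<tau> ^^ k) n + 1
        \<longrightarrow> v \<le> (\<tau> ^^ (k + 1)) n + 1) \<and>
     (\<forall>k. 0 < k \<and> k < tau_ord \<tau> n \<and> v < (\<tau> ^^ k) n + 1 \<and>
        \<tau> ((\<tau> ^^ k) n + 1) = (\<tau> ^^ (k + 1)) n + 1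
        \<longrightarrow> v < (\<tau> ^^ (k + 1)) n + 1) \<and>
     (tau_ord \<tau> n > 1 \<and> tau_ord \<tau> ((\<tau> ^^ (tau_ord \<tau> n - 1)) n + 1) = 1
        \<longrightarrow> v \<noteq> 0)"

lemma admissible_iff_steps:
  "admissible N \<tau> \<longleftrightarrow> \<tau> 1 = 0 \<and> (\<forall>n\<in>{1..<N}. admissible_step \<tau> n (\<tau> (n + 1)))"
  by (simp add: admissible_def admissible_step_def)

section \<open>Orbits descend strictly to zero\<close>

context
  fixes N :: nat and \<tau> :: "nat \<Rightarrow> nat"
  assumes adm: "admissible N \<tau>"
begin

lemma funpow_le:
  assumes n: "1 \<le> n" "n \<le> N" and "j \<le> tau_ord \<tau> n"
  shows "(\<tau> ^^ j) n \<le> n"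
  using assms(3)
proof (induction j)
  case (Suc j)
  then have "0 < (\<tau> ^^ j) n" using tau_ord_props(3)[OF adm n, of j] by simp
  with Suc n admissible_less[OF adm, of "(\<tau> ^^ j) n"] show ?case by simp
qed simp

lemma funpow_step_less:
  assumes n: "1 \<le> n" "n \<le> N" and "j < tau_ord \<tau> n"
  shows "(\<tau> ^^ Suc j) n < (\<tau> ^^ j) n"
  using funpow_le[OF n, of j] tau_ord_props(3)[OF adm n assms(3)] n assms(3)
    admissible_less[OF adm, of "(\<tau> ^^ j) n"] by simp

lemma funpow_less:
  assumes n: "1 \<le> n" "n \<le> N" and "i < j" "j \<le> tau_ord \<tau> n"
  shows "(\<tau> ^^ j) n < (\<tau> ^^ i) n"
  using assms(3,4)
proof (induction j)
  case (Suc j)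
  with funpow_step_less[OF n, of j] show ?case by (cases "i = j") auto
qed simp

lemma tau_ord_eq_1_iff:
  assumes n: "1 \<le> n" "n \<le> N"
  shows "tau_ord \<tau> n = 1 \<longleftrightarrow> \<tau> n = 0"
proof
  assume "tau_ord \<tau> n = 1"
  then show "\<tau> n = 0" using tau_ord_props(1)[OF adm n] by simp
next
  assume "\<tau> n = 0"
  then have "\<not> 1 < tau_ord \<tau> n" using tau_ord_props(3)[OF adm n, of 1] by auto
  then show "tau_ord \<tau> n = 1" using tau_ord_props(2)[OF adm n] by simp
qed

section \<open>Functions agreeing on an initial segment\<close>

text \<open>Iterates before the first zero stay in \<open>{1..N}\<close>; past
  \<open>tau_ord \<tau> n\<close> the possibly different junk values at 0 would enter.\<close>

lemma funpow_cong:
  assumes \<sigma>: "\<forall>n\<in>{1..N}. \<sigma> n = \<tau> n" and n: "1 \<le> n" "n \<le> N" and "j \<le> tau_ord \<tau> n"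
  shows "(\<sigma> ^^ j) n = (\<tau> ^^ j) n"
  using assms(4)
proof (induction j)
  case (Suc j)
  then have "0 < (\<tau> ^^ j) n" "(\<tau> ^^ j) n \<le> n"
    using tau_ord_props(3)[OF adm n, of j] funpow_le[OF n, of j] by auto
  with Suc \<sigma> n show ?case by simp
qed simp

lemma tau_ord_cong:
  assumes \<sigma>: "\<forall>n\<in>{1..N}. \<sigma> n = \<tau> n" and n: "1 \<le> n" "n \<le> N"
  shows "tau_ord \<sigma> n = tau_ord \<tau> n"
  unfolding tau_ord_def[of \<sigma>]
proof (rule Least_equality)
  show "(\<sigma> ^^ tau_ord \<tau> n) n = 0"
    using funpow_cong[OF \<sigma> n order_refl] tau_ord_props(1)[OF adm n] by simp
  show "tau_ord \<tau> n \<le> j" if "(\<sigma> ^^ j) n = 0" for j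
    using that funpow_cong[OF \<sigma> n, of j] tau_ord_props(3)[OF adm n, of j]
    by (cases "j < tau_ord \<tau> n") auto
qed

lemma admissible_step_cong:
  assumes \<sigma>: "\<forall>n\<in>{1..N}. \<sigma> n = \<tau> n" and n: "1 \<le> n" "n \<le> N"
  shows "admissible_step \<sigma> n v \<longleftrightarrow> admissible_step \<tau> n v"
proof -
  have it: "(\<sigma> ^^ k) n = (\<tau> ^^ k) n" "(\<sigma> ^^ (k + 1)) n = (\<tau> ^^ (k + 1)) n"
    if "k < tau_ord \<tau> n" for k
    using funpow_cong[OF \<sigma> n, of k] funpow_cong[OF \<sigma> n, of "k + 1"] that by simp_all
  \<comment> \<open>\<open>0 < k\<close> keeps the arguments in (D) and (E) inside the common
    domain: for \<open>k = 0\<close> the argument would be \<open>n + 1\<close>, which may be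
    \<open>N + 1\<close>.\<close>
  have le: "(\<tau> ^^ k) n + 1 \<le> N" if "0 < k" "k < tau_ord \<tau> n" for k
    using funpow_less[OF n, of 0 k] that n by simp
  have s: "\<sigma> ((\<tau> ^^ k) n + 1) = \<tau> ((\<tau> ^^ k) n + 1)"
    and o: "tau_ord \<sigma> ((\<tau> ^^ k) n + 1) = tau_ord \<tau> ((\<tau> ^^ k) n + 1)"
    if "0 < k" "k < tau_ord \<tau> n" for k
    using \<sigma> tau_ord_cong[OF \<sigma>, of "(\<tau> ^^ k) n + 1"] le[OF that] by simp_all
  have \<sigma>n: "\<sigma> n = \<tau> n" using \<sigma> n by simp
  have last: "0 < tau_ord \<tau> n - 1" "tau_ord \<tau> n - 1 < tau_ord \<tau> n" if "1 < tau_ord \<tau> n"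
    using that by simp_all
  show ?thesis
    unfolding admissible_step_def tau_ord_cong[OF \<sigma> n]
    \<comment> \<open>The congruence rules supply the bounds on \<open>k\<close>, and
      \<open>1 < tau_ord \<tau> n\<close> in (E), under which the rewrite rules apply.\<close>
    by (simp only: \<sigma>n it s o last cong: conj_cong imp_cong)
qed

lemma admissible_extension_iff:
  assumes \<sigma>: "\<forall>n\<in>{1..N}. \<sigma> n = \<tau> n" and "1 \<le> N"
  shows "admissible (N + 1) \<sigma> \<longleftrightarrow> admissible_step \<tau> N (\<sigma> (N + 1))"
proof -
  have "admissible_step \<sigma> n (\<sigma> (n + 1))" if "n \<in> {1..<N}" for n
    using adm \<sigma> that admissible_step_cong[OF \<sigma>, of n] by (simp add: admissible_iff_steps)
  moreover have "\<sigma> 1 = 0" using \<sigma> adm assms(2) by (simp add: admissible_iff_steps)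
  moreover have "{1..<N + 1} = insert N {1..<N}" using assms(2) by auto
  ultimately show ?thesis
    using admissible_step_cong[OF \<sigma> assms(2) order_refl] by (auto simp: admissible_iff_steps)
qed

section \<open>Values permitted at \<open>N + 1\<close>\<close>

text \<open>Markers lie strictly between 0 and \<open>N\<close>, which removes both ends of the
  orbit; by (B), strict inequality is the failure of the equation in (D).\<close>

lemma orbit_markers_eq:
  assumes N: "1 \<le> N"
  shows "orbit_markers N \<tau> =
    {(\<tau> ^^ k) N | k. 0 < k \<and> k < tau_ord \<tau> N \<and> \<tau> ((\<tau> ^^ k) N + 1) \<noteq> (\<tau> ^^ (k + 1)) N + 1}"
    (is "_ = ?R")
proof (intro equalityI subsetI)
  fix m assume "m \<in> orbit_markers N \<tau>"
  then obtain k where k: "k \<le> tau_ord \<tau> N" "m = (\<tau> ^^ k) N" "1 \<le> m" "m < N"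
    "\<tau> (m + 1) < \<tau> m + 1"
    by (auto simp: orbit_markers_def markers_def orbit_def)
  moreover from k have "k \<noteq> 0" by (intro notI) simp
  moreover have "k \<noteq> tau_ord \<tau> N" using k tau_ord_props(1)[OF adm N order_refl] by auto
  ultimately show "m \<in> ?R" by auto
next
  fix m assume "m \<in> ?R"
  then obtain k where k: "0 < k" "k < tau_ord \<tau> N" "m = (\<tau> ^^ k) N" "\<tau> (m + 1) \<noteq> \<tau> m + 1"
    by auto
  then have m: "0 < m" "m < N"
    using tau_ord_props(3)[OF adm N order_refl, of k] funpow_less[OF N order_refl, of 0 k] by auto
  then have "\<tau> (m + 1) \<le> \<tau> m + 1" using adm by (auto simp: admissible_def)
  with k m show "m \<in> orbit_markers N \<tau>"
    by (auto simp: orbit_markers_def markers_def orbit_def intro!: exI[of _ k])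
qed

lemma admissible_step_iff:
  assumes N: "1 \<le> N"
  shows "admissible_step \<tau> N v \<longleftrightarrow>
    (\<exists>m\<in>insert N (orbit_markers N \<tau>). v = \<tau> m + 1) \<or>
    v = 0 \<and> (\<forall>m\<in>orbit_markers N \<tau>. 0 < \<tau> m)"
    (is "?L \<longleftrightarrow> ?R")
proof -
  define r where "r = tau_ord \<tau> N"
  define a where "a k = (\<tau> ^^ k) N" for k
  have \<tau>a: "\<tau> (a k) = a (k + 1)" for k by (simp add: a_def)
  have r: "1 \<le> r" "a r = 0" and pos: "\<And>k. k < r \<Longrightarrow> 0 < a k"
    using tau_ord_props[OF adm N order_refl] by (simp_all add: a_def r_def)
  have less: "a j < a i" if "i < j" "j \<le> r" for i j
    using that funpow_less[OF N order_refl] by (simp add: a_def r_def)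
  have markers: "orbit_markers N \<tau> = {a k | k. 0 < k \<and> k < r \<and> \<tau> (a k + 1) \<noteq> a (k + 1) + 1}"
    using orbit_markers_eq[OF N] by (simp add: a_def r_def)
  have a1: "a 1 = \<tau> N" by (simp add: a_def)
  have le: "a k + 1 \<le> N" if "0 < k" "k < r" for k
    using less[of 0 k] that by (simp add: a_def)
  have E: "tau_ord \<tau> (a (r - 1) + 1) = 1 \<longleftrightarrow> \<tau> (a (r - 1) + 1) = 0" if "1 < r"
    using tau_ord_eq_1_iff[of "a (r - 1) + 1"] le[of "r - 1"] that by simp
  \<comment> \<open>As \<open>a r = 0\<close>, (B) leaves only the values 0 and 1.\<close>
  have last: "\<tau> (a (r - 1) + 1) \<noteq> 0 \<longleftrightarrow> \<tau> (a (r - 1) + 1) = a r + 1" if "1 < r"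
  proof -
    have "\<tau> (a (r - 1) + 1) \<le> \<tau> (a (r - 1)) + 1"
      using adm le[of "r - 1"] pos[of "r - 1"] that by (auto simp: admissible_def)
    moreover have "\<tau> (a (r - 1)) = 0" using \<tau>a[of "r - 1"] r that by simp
    ultimately show ?thesis using r(2) by linarith
  qed
  \<comment> \<open>The only orbit marker that \<tau> can send to 0 is
    \<open>a (r - 1)\<close>.\<close>
  have zero: "(\<forall>m\<in>orbit_markers N \<tau>. 0 < \<tau> m) \<longleftrightarrow> (1 < r \<longrightarrow> \<tau> (a (r - 1) + 1) \<noteq> 0)"
  proof
    assume A: "\<forall>m\<in>orbit_markers N \<tau>. 0 < \<tau> m"
    show "1 < r \<longrightarrow> \<tau> (a (r - 1) + 1) \<noteq> 0"
    proof (intro impI notI)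
      assume "1 < r" "\<tau> (a (r - 1) + 1) = 0"
      then have "a (r - 1) \<in> orbit_markers N \<tau>" unfolding markers by force
      then show False using A \<tau>a[of "r - 1"] r \<open>1 < r\<close> by force
    qed
  next
    assume A: "1 < r \<longrightarrow> \<tau> (a (r - 1) + 1) \<noteq> 0"
    show "\<forall>m\<in>orbit_markers N \<tau>. 0 < \<tau> m"
    proof
      fix m assume "m \<in> orbit_markers N \<tau>"
      then obtain k where k: "m = a k" "0 < k" "k < r" "\<tau> (a k + 1) \<noteq> a (k + 1) + 1"
        unfolding markers by auto
      have "k \<noteq> r - 1" using k A last by auto
      then show "0 < \<tau> m" using k \<tau>a[of k] pos[of "k + 1"] by simp
    qed
  qed
  have step: "admissible_step \<tau> N v \<longleftrightarrow> v \<le> a 1 + 1 \<and>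
     (\<forall>k. 0 < k \<and> k < r \<and> v < a k + 1 \<longrightarrow> v \<le> a (k + 1) + 1) \<and>
     (\<forall>k. 0 < k \<and> k < r \<and> v < a k + 1 \<and> \<tau> (a k + 1) = a (k + 1) + 1 \<longrightarrow> v < a (k + 1) + 1) \<and>
     (1 < r \<and> \<tau> (a (r - 1) + 1) = 0 \<longrightarrow> v \<noteq> 0)"
    (is "_ \<longleftrightarrow> ?B \<and> ?C \<and> ?D \<and> _")
  proof -
    have "admissible_step \<tau> N v \<longleftrightarrow> ?B \<and> ?C \<and> ?D \<and>
        (1 < r \<and> tau_ord \<tau> (a (r - 1) + 1) = 1 \<longrightarrow> v \<noteq> 0)"
      \<comment> \<open>\<open>a1\<close> goes first, since \<open>a_def\<close> would turn
        \<open>a 1\<close> into \<open>(\<tau> ^^ 1) N\<close>.\<close>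
      unfolding admissible_step_def a1 unfolding a_def r_def by (rule refl)
    then show ?thesis by (simp only: E cong: conj_cong)
  qed
  show ?thesis
  proof
    assume L: ?L
    show ?R
    proof (cases "v = 0")
      case True
      moreover have "1 < r \<and> \<tau> (a (r - 1) + 1) = 0 \<longrightarrow> v \<noteq> 0"
        using L unfolding step by (elim conjE)
      ultimately show ?thesis unfolding zero by (intro disjI2) simp
    next
      case False
      then have ar: "a r < v" using r by simp
      \<comment> \<open>The first orbit point below \<open>v\<close>; it exists because
        \<open>a r = 0\<close>.\<close>
      define k where "k = (LEAST k. a k < v)"
      have k: "a k < v" "k \<le> r"
        unfolding k_def by (rule LeastI, rule ar, rule Least_le, rule ar)
      have min: "v \<le> a j" if "j < k" for j
        using not_less_Least[OF that[unfolded k_def]] by simp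
      have "a 1 < a 0" using less[of 0 1] r by simp
      consider "k \<le> 1" | j where "k = j + 1" "0 < j" "j < r"
      proof (cases "k \<le> 1")
        case False
        then show ?thesis using k(2) that(2)[of "k - 1"] by simp
      qed
      then show ?thesis
      proof cases
        case 1
        then have "a 1 < v" using k \<open>a 1 < a 0\<close> by (cases k) auto
        with L have "v = a 1 + 1" unfolding step by linarith
        with a1 show ?thesis by auto
      next
        case (2 j)
        \<comment> \<open>Minimality of \<open>k = j + 1\<close> triggers (C), which together with
          \<open>a k < v\<close> forces \<open>v = a (j + 1) + 1\<close>; (D) then makes
          \<open>a j\<close> a marker.\<close>
        have "v \<le> a j" using min 2 by simp
        then have "v \<le> a (j + 1) + 1" "\<tau> (a j + 1) = a (j + 1) + 1 \<longrightarrow> v < a (j + 1) + 1"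
          using L 2 unfolding step by simp_all
        then have "v = a (j + 1) + 1" "\<tau> (a j + 1) \<noteq> a (j + 1) + 1"
          using k 2 by auto
        then have "a j \<in> orbit_markers N \<tau>" "v = \<tau> (a j) + 1"
          using 2 \<tau>a unfolding markers by auto
        then show ?thesis by blast
      qed
    qed
  next
    assume R: ?R
    then consider "v = a 1 + 1"
      | k where "0 < k" "k < r" "\<tau> (a k + 1) \<noteq> a (k + 1) + 1" "v = a (k + 1) + 1"
      | "v = 0" "1 < r \<longrightarrow> \<tau> (a (r - 1) + 1) \<noteq> 0"
      unfolding zero unfolding markers using a1 \<tau>a by auto
    then show ?L
    proof cases
      case 1
      \<comment> \<open>Hence (C) and (D) hold vacuously.\<close>
      then have "\<not> v < a k + 1" if "0 < k" "k < r" for k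
        using less[of 1 k] that by (cases "k = 1") auto
      then show ?thesis using 1 unfolding step by auto
    next
      case (2 k)
      have "a (k + 1) < a 1" using less[of 1 "k + 1"] 2 by simp
      \<comment> \<open>Indices above \<open>k\<close> violate \<open>v < a j + 1\<close>, and those
        below \<open>k\<close> satisfy (C) and (D) strictly. At \<open>j = k\<close>, (C) is an
        equality and (D) is vacuous because \<open>a k\<close> is a marker.\<close>
      moreover have "j = k \<or> v < a (j + 1) + 1" if "0 < j" "j < r" "v < a j + 1" for j
      proof -
        have "\<not> k + 1 \<le> j" using less[of "k + 1" j] that 2 by (cases "j = k + 1") auto
        then consider "j = k" | "j < k" by linarith
        then show ?thesis using less[of "j + 1" "k + 1"] 2 by cases auto
      qed
      ultimately show ?thesis using 2(3,4) unfolding step by (auto dest: less_imp_le)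
    next
      case 3
      then show ?thesis unfolding step by simp
    qed
  qed
qed

section \<open>From sets of markers to labelled values\<close>

text \<open>The values decrease with the label, so the last one is the least. If the count is 0, the
  last value is \<tau>(N), which belongs to no orbit marker; hence the separate disjunct.\<close>

lemma marker_values_positive_iff:
  assumes N: "1 \<le> N"
  shows "(\<forall>m\<in>orbit_markers N \<tau>. 0 < \<tau> m) \<longleftrightarrow>
    marker_value N \<tau> (marker_count N \<tau>) > 0 \<or> marker_count N \<tau> = 0"
proof (cases "marker_count N \<tau> = 0")
  case True
  then show ?thesis by (simp add: marker_count_def finite_orbit_markers)
next
  case False
  have "marker_value N \<tau> (marker_count N \<tau>) \<le> marker_value N \<tau> i" if "i \<le> marker_count N \<tau>" for i
    using marker_value_decreasing[OF adm N, of i "marker_count N \<tau>"] that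
    by (cases "i = marker_count N \<tau>") auto
  then show ?thesis
    using False unfolding marker_label_set[symmetric]
    by (force simp: marker_value_def[symmetric])
qed

end

text \<open>Label 0 is \<open>N\<close>, and the later labels run through the orbit markers, so a
  quantifier over labels becomes one over a set.\<close>

lemma ex_marker_value_iff:
  "(\<exists>i\<le>marker_count N \<tau>. P (marker_value N \<tau> i)) \<longleftrightarrow>
    (\<exists>m\<in>insert N (orbit_markers N \<tau>). P (\<tau> m))"
proof -
  have "{..marker_count N \<tau>} = insert 0 {1..marker_count N \<tau>}" by auto
  then have "marker_label N \<tau> ` {..marker_count N \<tau>} = insert N (orbit_markers N \<tau>)"
    using marker_label_set[of N \<tau>] by (simp add: marker_label_def)
  from this[symmetric] show ?thesis unfolding marker_value_def by (simp only: bex_simps atMost_iff Bex_def image_iff) blast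
qed

theorem theorem2p2:
  fixes N :: nat and \<tau> \<sigma> :: "nat \<Rightarrow> nat"
  assumes "N \<ge> 1"
    and "admissible N \<tau>"
    and extension: "\<forall>n\<in>{1..N}. \<sigma> n = \<tau> n"
  shows "admissible (N + 1) \<sigma> \<longleftrightarrow>
    (\<exists>i\<le>marker_count N \<tau>. \<sigma> (N + 1) = marker_value N \<tau> i + 1) \<or>
    (\<sigma> (N + 1) = 0 \<and>
      (marker_value N \<tau> (marker_count N \<tau>) > 0 \<or> marker_count N \<tau> = 0))"
  unfolding admissible_extension_iff[OF assms(2) extension assms(1)]
    admissible_step_iff[OF assms(2,1)] marker_values_positive_iff[OF assms(2,1), symmetric]
    ex_marker_value_iff[where P = "\<lambda>x. \<sigma> (N + 1) = x + 1"] ..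

end
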